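(* Let $\mathrm{I}$ be a set, $\mathbf{C}$ a category and $\mathbf{G}:\mathbf{GLD}(\mathrm{I})\to\mathbf{C}$ a $\mathbf{C}$-gluing data functor. Let $N$ be an object of $\mathbf{C}$ and let $\psi=(\psi_a:N\to \mathbf{G}(a))_{a}$ be a family of morphisms of $\mathbf{C}$ indexed by the objects $a$ of $\mathbf{GLD}(\mathrm{I})$. The following statements are equivalent: 1. $(N,\psi)$ is a cone over the underlying diagram of $\mathbf{G}$; 2. for all $i,j,k\in\mathrm{I}$ and $n\in\{j,k\}$: (a) $\psi_{[i,j]}=\mathbf{G}(\tau_{[i,j]})\circ\psi_{[j,i]}$; (b) $\psi_{[i,j]}=\mathbf{G}(\eta_{i,[i,j]})\circ\psi_{i}$; (c) $\psi_{[i,j,k]}=\mathbf{G}(\eta_{[i,n],[i,j,k]})\circ\psi_{[i,n]}$; 3. for all $i,j,k\in\mathrm{I}$ and $n\in\{j,k\}$: (a) $\psi_{[i,j]}=\mathbf{G}(\tau_{[i,j]}\circ\eta_{j,[j,i]})\circ\psi_{j}$; (b) $\psi_{[i,j]}=\mathbf{G}(\eta_{i,[i,j]})\circ\psi_{i}$; (c) $\psi_{[i,j,k]}=\mathbf{G}(\eta_{[i,n],[i,j,k]})\circ\psi_{[i,n]}$.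
   Context: Gluing Data category. For a set $\mathrm{I}$, the category $\mathbf{GLD}(\mathrm{I})$ is defined as follows. Its objects are the equivalence classes of elements of $\mathrm{I}\cup\mathrm{I}^2\cup\mathrm{I}^3$ (disjoint union) for the equivalence relation generated by $i\sim(i,i)$, $i\sim(i,i,i)$, $(i,j,k)\sim(i,k,j)$, $(i,i,j)\sim(i,j)$, $(i,j,j)\sim(i,j)$ for $i,j,k\in\mathrm{I}$. The classes of $i$, $(i,j)$, $(i,j,k)$ are written $[i]$ (or simply $i$), $[i,j]$, $[i,j,k]$. Between any two objects there is at most one morphism. The morphisms are the identities, the following morphisms for all $i,j,k\in\mathrm{I}$ and $n\in\{j,k\}$, and all their composites: $\eta_{i,[i,j]}:i\to[i,j]$; $\tau_{[i,j]}:[j,i]\to[i,j]$; $\eta_{[i,n],[i,j,k]}:[i,n]\to[i,j,k]$; $\tau_{k_{[i,j]}}:[j,i,k]\to[i,j,k]$. Gluing data functor. A $\mathbf{C}$-gluing data functor of type $\mathrm{I}$ is a functor $\mathbf{G}:\mathbf{GLD}(\mathrm{I})\to\mathbf{C}$ such that, for all distinct $i,j,k\in\mathrm{I}$, the object $\mathbf{G}([i,j,k])$ with the morphisms $\mathbf{G}(\eta_{[i,j],[i,j,k]})$ and $\mathbf{G}(\eta_{[i,k],[i,j,k]})$ is a pushout in $\mathbf{C}$ of $\mathbf{G}(\eta_{i,[i,j]})$ and $\mathbf{G}(\eta_{i,[i,k]})$. A cone over $\mathbf{G}$ is a pair $(N,\psi)$ with $\mathbf{G}(f)\circ\psi_a=\psi_b$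 for every morphism $f:a\to b$ of $\mathbf{GLD}(\mathrm{I})$. *)

theory Defs
  imports Main
begin

text \<open>
  A category is given by a set of objects and a set of arrows inside two ambient types.
  Composition \<open>g \<odot>\<^bsub>C\<^esub> f\<close> (first \<open>f\<close>, then \<open>g\<close>) is a total function, meaningful
  only if the domain of \<open>g\<close> is the codomain of \<open>f\<close>.
\<close>

record ('o, 'm) category =
  Obj :: "'o set"
  Arr :: "'m set"
  Dom :: "'m \<Rightarrow> 'o"
  Cod :: "'m \<Rightarrow> 'o"
  Ident :: "'o \<Rightarrow> 'm"
  Comp :: "'m \<Rightarrow> 'm \<Rightarrow> 'm" (infixl "\<odot>\<index>" 70)

definition Hom :: "('o, 'm, 'x) category_scheme \<Rightarrow> 'o \<Rightarrow> 'o \<Rightarrow> 'm set" where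
  "Hom C a b = {f \<in> Arr C. Dom C f = a \<and> Cod C f = b}"

locale category =
  fixes C :: "('o, 'm, 'x) category_scheme" (structure)
  assumes Dom_in_Obj: "f \<in> Arr C \<Longrightarrow> Dom C f \<in> Obj C"
    and Cod_in_Obj: "f \<in> Arr C \<Longrightarrow> Cod C f \<in> Obj C"
    and Ident_in_Hom: "a \<in> Obj C \<Longrightarrow> Ident C a \<in> Hom C a a"
    and Comp_in_Hom: "f \<in> Hom C a b \<Longrightarrow> g \<in> Hom C b c \<Longrightarrow> g \<odot> f \<in> Hom C a c"
    and Comp_Ident: "f \<in> Hom C a b \<Longrightarrow> f \<odot> Ident C a = f"
    and Ident_Comp: "f \<in> Hom C a b \<Longrightarrow> Ident C b \<odot> f = f"
    and Comp_assoc: "f \<in> Hom C a b \<Longrightarrow> g \<in> Hom C b c \<Longrightarrow> h \<in> Hom C c d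
      \<Longrightarrow> (h \<odot> g) \<odot> f = h \<odot> (g \<odot> f)"

record ('o1, 'm1, 'o2, 'm2) cat_functor =
  ObMap :: "'o1 \<Rightarrow> 'o2"
  ArMap :: "'m1 \<Rightarrow> 'm2"

definition is_functor ::
  "('o1, 'm1, 'x) category_scheme \<Rightarrow> ('o2, 'm2, 'y) category_scheme
    \<Rightarrow> ('o1, 'm1, 'o2, 'm2, 'z) cat_functor_scheme \<Rightarrow> bool" where
  "is_functor J C G \<longleftrightarrow>
     category J \<and> category C \<and>
     (\<forall>a \<in> Obj J. ObMap G a \<in> Obj C) \<and>
     (\<forall>f \<in> Arr J. ArMap G f \<in> Hom C (ObMap G (Dom J f)) (ObMap G (Cod J f))) \<and>
     (\<forall>a \<in> Obj J. ArMap G (Ident J a) = Ident C (ObMap G a)) \<and>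
     (\<forall>f \<in> Arr J. \<forall>g \<in> Arr J. Dom J g = Cod J f \<longrightarrow>
        ArMap G (g \<odot>\<^bsub>J\<^esub> f) = ArMap G g \<odot>\<^bsub>C\<^esub> ArMap G f)"

definition is_pushout ::
  "('o, 'm, 'x) category_scheme \<Rightarrow> 'm \<Rightarrow> 'm \<Rightarrow> 'o \<Rightarrow> 'm \<Rightarrow> 'm \<Rightarrow> bool" where
  "is_pushout C f g P p q \<longleftrightarrow>
     f \<in> Arr C \<and> g \<in> Arr C \<and> Dom C f = Dom C g \<and>
     P \<in> Obj C \<and> p \<in> Hom C (Cod C f) P \<and> q \<in> Hom C (Cod C g) P \<and>
     p \<odot>\<^bsub>C\<^esub> f = q \<odot>\<^bsub>C\<^esub> g \<and>
     (\<forall>X \<in> Obj C. \<forall>u \<in> Hom C (Cod C f) X. \<forall>v \<in> Hom C (Cod C g) X.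
        u \<odot>\<^bsub>C\<^esub> f = v \<odot>\<^bsub>C\<^esub> g \<longrightarrow>
        (\<exists>!w. w \<in> Hom C P X \<and> w \<odot>\<^bsub>C\<^esub> p = u \<and> w \<odot>\<^bsub>C\<^esub> q = v))"

definition is_cone ::
  "('o1, 'm1, 'x) category_scheme \<Rightarrow> ('o2, 'm2, 'y) category_scheme
    \<Rightarrow> ('o1, 'm1, 'o2, 'm2, 'z) cat_functor_scheme \<Rightarrow> 'o2 \<Rightarrow> ('o1 \<Rightarrow> 'm2) \<Rightarrow> bool" where
  "is_cone J C G N \<psi> \<longleftrightarrow>
     N \<in> Obj C \<and>
     (\<forall>a \<in> Obj J. \<psi> a \<in> Hom C N (ObMap G a)) \<and>
     (\<forall>a \<in> Obj J. \<forall>b \<in> Obj J. \<forall>f \<in> Hom J a b. ArMap G f \<odot>\<^bsub>C\<^esub> \<psi> a = \<psi> b)"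

text \<open>The disjoint union of \<open>I\<close>, \<open>I\<^sup>2\<close> and \<open>I\<^sup>3\<close> consists of the tuples with entries in \<open>I\<close>.\<close>

datatype 'i tuple = T1 'i | T2 'i 'i | T3 'i 'i 'i

definition tuples :: "'i set \<Rightarrow> 'i tuple set" where
  "tuples I = {t. set_tuple t \<subseteq> I}"

inductive gld_gen :: "'i set \<Rightarrow> 'i tuple \<Rightarrow> 'i tuple \<Rightarrow> bool" for I where
  "i \<in> I \<Longrightarrow> gld_gen I (T1 i) (T2 i i)"
| "i \<in> I \<Longrightarrow> gld_gen I (T1 i) (T3 i i i)"
| "i \<in> I \<Longrightarrow> j \<in> I \<Longrightarrow> k \<in> I \<Longrightarrow> gld_gen I (T3 i j k) (T3 i k j)"
| "i \<in> I \<Longrightarrow> j \<in> I \<Longrightarrow> gld_gen I (T3 i i j) (T2 i j)"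
| "i \<in> I \<Longrightarrow> j \<in> I \<Longrightarrow> gld_gen I (T3 i j j) (T2 i j)"

definition gld_rel :: "'i set \<Rightarrow> ('i tuple \<times> 'i tuple) set" where
  "gld_rel I = {(s, t). s \<in> tuples I \<and> t \<in> tuples I \<and> equivclp (gld_gen I) s t}"

lemma equiv_gld_rel: "equiv (tuples I) (gld_rel I)"
  by (rule equivI)
    (auto simp: gld_rel_def refl_on_def sym_def trans_def
      intro: equivclp_sym equivclp_trans)

definition cls1 :: "'i set \<Rightarrow> 'i \<Rightarrow> 'i tuple set" where
  "cls1 I i = gld_rel I `` {T1 i}"

definition cls2 :: "'i set \<Rightarrow> 'i \<Rightarrow> 'i \<Rightarrow> 'i tuple set" where
  "cls2 I i j = gld_rel I `` {T2 i j}"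

definition cls3 :: "'i set \<Rightarrow> 'i \<Rightarrow> 'i \<Rightarrow> 'i \<Rightarrow> 'i tuple set" where
  "cls3 I i j k = gld_rel I `` {T3 i j k}"

text \<open>
  Since there is at most one arrow between two objects, an arrow is represented by the pair
  of its domain and its codomain.
\<close>

type_synonym 'i gld_arrow = "'i tuple set \<times> 'i tuple set"

definition eta :: "'i tuple set \<Rightarrow> 'i tuple set \<Rightarrow> 'i gld_arrow" where
  "eta a b = (a, b)"

definition tau2 :: "'i set \<Rightarrow> 'i \<Rightarrow> 'i \<Rightarrow> 'i gld_arrow" where
  "tau2 I i j = (cls2 I j i, cls2 I i j)"

definition tau3 :: "'i set \<Rightarrow> 'i \<Rightarrow> 'i \<Rightarrow> 'i \<Rightarrow> 'i gld_arrow" where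
  "tau3 I k i j = (cls3 I j i k, cls3 I i j k)"

inductive_set gld_arrows :: "'i set \<Rightarrow> 'i gld_arrow set" for I where
  gld_ident: "a \<in> tuples I // gld_rel I \<Longrightarrow> (a, a) \<in> gld_arrows I"
| gld_eta12: "i \<in> I \<Longrightarrow> j \<in> I \<Longrightarrow> eta (cls1 I i) (cls2 I i j) \<in> gld_arrows I"
| gld_tau2: "i \<in> I \<Longrightarrow> j \<in> I \<Longrightarrow> tau2 I i j \<in> gld_arrows I"
| gld_eta23: "i \<in> I \<Longrightarrow> j \<in> I \<Longrightarrow> k \<in> I \<Longrightarrow> n \<in> {j, k}
    \<Longrightarrow> eta (cls2 I i n) (cls3 I i j k) \<in> gld_arrows I"
| gld_tau3: "i \<in> I \<Longrightarrow> j \<in> I \<Longrightarrow> k \<in> I \<Longrightarrow> tau3 I k i j \<in> gld_arrows I"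
| gld_comp: "(a, b) \<in> gld_arrows I \<Longrightarrow> (b, c) \<in> gld_arrows I \<Longrightarrow> (a, c) \<in> gld_arrows I"

definition GLD :: "'i set \<Rightarrow> ('i tuple set, 'i gld_arrow) category" where
  "GLD I = \<lparr>Obj = tuples I // gld_rel I, Arr = gld_arrows I, Dom = fst, Cod = snd,
     Ident = (\<lambda>a. (a, a)), Comp = (\<lambda>g f. (fst f, snd g))\<rparr>"

lemma cls_in_quotient:
  "i \<in> I \<Longrightarrow> cls1 I i \<in> tuples I // gld_rel I"
  "i \<in> I \<Longrightarrow> j \<in> I \<Longrightarrow> cls2 I i j \<in> tuples I // gld_rel I"
  "i \<in> I \<Longrightarrow> j \<in> I \<Longrightarrow> k \<in> I \<Longrightarrow> cls3 I i j k \<in> tuples I // gld_rel I"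
  unfolding cls1_def cls2_def cls3_def by (auto intro!: quotientI simp: tuples_def)

lemma gld_arrows_endpoints:
  "f \<in> gld_arrows I \<Longrightarrow> fst f \<in> tuples I // gld_rel I \<and> snd f \<in> tuples I // gld_rel I"
  by (induction rule: gld_arrows.induct)
    (auto simp: eta_def tau2_def tau3_def cls_in_quotient)

lemma category_GLD: "category (GLD I)"
  by unfold_locales
    (auto simp: GLD_def Hom_def intro: gld_ident gld_comp dest: gld_arrows_endpoints)

definition gluing_data_functor ::
  "'i set \<Rightarrow> ('o, 'm, 'x) category_scheme
    \<Rightarrow> ('i tuple set, 'i gld_arrow, 'o, 'm, 'z) cat_functor_scheme \<Rightarrow> bool" where
  "gluing_data_functor I C G \<longleftrightarrow>
     is_functor (GLD I) C G \<and>
     (\<forall>i \<in> I. \<forall>j \<in> I. \<forall>k \<in> I. i \<noteq> j \<and> i \<noteq> k \<and> j \<noteq> k \<longrightarrow>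
        is_pushout C
          (ArMap G (eta (cls1 I i) (cls2 I i j))) (ArMap G (eta (cls1 I i) (cls2 I i k)))
          (ObMap G (cls3 I i j k))
          (ArMap G (eta (cls2 I i j) (cls3 I i j k))) (ArMap G (eta (cls2 I i k) (cls3 I i j k))))"

end

theory Submission
  imports Defs
begin

text \<open>
  Compatibility of \<open>\<psi>\<close> with an arrow is inherited by composites, since \<open>G\<close> preserves composition
  (lemma \<open>functor_image_comp_cone\<close>). It therefore suffices to test the generators of the arrows
  of \<open>GLD I\<close>. Apart from the identities, only the triple transpositions among them do not occur
  in the second statement. They come for free because there is at most one arrow between two objects: the square
  with sides \<open>[j,i] \<rightarrow> [j,i,k] \<rightarrow> [i,j,k]\<close> and \<open>[j,i] \<rightarrow> [i,j] \<rightarrow> [i,j,k]\<close>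
  commutes, so that
  \<open>G(\<tau>\<^sub>k) \<psi>\<^bsub>[j,i,k]\<^esub> = G(\<tau>\<^sub>k) G(\<eta>) \<psi>\<^bsub>[j,i]\<^esub> = G(\<eta>) G(\<tau>) \<psi>\<^bsub>[j,i]\<^esub> = G(\<eta>) \<psi>\<^bsub>[i,j]\<^esub> = \<psi>\<^bsub>[i,j,k]\<^esub>\<close>
  (lemma \<open>gld_coneI\<close>). The third statement is the second one with \<open>\<psi>\<^bsub>[j,i]\<^esub>\<close> rewritten as
  \<open>G(\<eta>) \<psi>\<^bsub>j\<^esub>\<close> by clause (b) for the pair \<open>(j, i)\<close>.
\<close>

text \<open>
  Associativity in \<open>C\<close> trades \<open>\<psi> b\<close> for \<open>\<psi> a\<close> in a condition along \<open>g\<close>. The equation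
  serves both to pass from \<open>f\<close> and \<open>g\<close> to their composite and to
  compare the two sides of the commuting square.
\<close>

lemma functor_image_comp_cone:
  assumes G: "is_functor J C G"
    and f: "f \<in> Hom J a b" and g: "g \<in> Hom J b c"
    and \<psi>: "\<psi> a \<in> Hom C N (ObMap G a)"
    and compat: "ArMap G f \<odot>\<^bsub>C\<^esub> \<psi> a = \<psi> b"
  shows "ArMap G (g \<odot>\<^bsub>J\<^esub> f) \<odot>\<^bsub>C\<^esub> \<psi> a = ArMap G g \<odot>\<^bsub>C\<^esub> \<psi> b"
proof -
  interpret C: category C using G by (simp add: is_functor_def)
  have fg: "f \<in> Arr J" "g \<in> Arr J" "Dom J f = a" "Cod J f = b" "Dom J g = b" "Cod J g = c"
    using f g by (auto simp: Hom_def)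
  have Gf: "ArMap G f \<in> Hom C (ObMap G a) (ObMap G b)"
    and Gg: "ArMap G g \<in> Hom C (ObMap G b) (ObMap G c)"
    using G fg unfolding is_functor_def by metis+
  have "ArMap G (g \<odot>\<^bsub>J\<^esub> f) = ArMap G g \<odot>\<^bsub>C\<^esub> ArMap G f"
    using G fg by (simp add: is_functor_def)
  then show ?thesis
    using C.Comp_assoc[OF \<psi> Gf Gg] compat by simp
qed

lemma Hom_GLD_iff: "f \<in> Hom (GLD I) a b \<longleftrightarrow> f = (a, b) \<and> (a, b) \<in> gld_arrows I"
  by (auto simp: Hom_def GLD_def)

lemma Comp_GLD: "(b', c) \<odot>\<^bsub>GLD I\<^esub> (a, b) = (a, c)"
  by (simp add: GLD_def)

lemma Obj_GLD: "Obj (GLD I) = tuples I // gld_rel I"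
  by (simp add: GLD_def)

text \<open>
  Induction on how an arrow is built from the generators. The triple transpositions are absent from
  the hypotheses because the commuting square derives their case from \<open>tau\<close> and \<open>eta23\<close>.
\<close>

lemma gld_coneI:
  assumes G: "is_functor (GLD I) C G"
    and N: "N \<in> Obj C"
    and \<psi>: "\<And>a. a \<in> Obj (GLD I) \<Longrightarrow> \<psi> a \<in> Hom C N (ObMap G a)"
    and tau: "\<And>i j. i \<in> I \<Longrightarrow> j \<in> I \<Longrightarrow>
      ArMap G (tau2 I i j) \<odot>\<^bsub>C\<^esub> \<psi> (cls2 I j i) = \<psi> (cls2 I i j)"
    and eta12: "\<And>i j. i \<in> I \<Longrightarrow> j \<in> I \<Longrightarrow>
      ArMap G (eta (cls1 I i) (cls2 I i j)) \<odot>\<^bsub>C\<^esub> \<psi> (cls1 I i) = \<psi> (cls2 I i j)"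
    and eta23: "\<And>i j k n. i \<in> I \<Longrightarrow> j \<in> I \<Longrightarrow> k \<in> I \<Longrightarrow> n \<in> {j, k} \<Longrightarrow>
      ArMap G (eta (cls2 I i n) (cls3 I i j k)) \<odot>\<^bsub>C\<^esub> \<psi> (cls2 I i n) = \<psi> (cls3 I i j k)"
  shows "is_cone (GLD I) C G N \<psi>"
proof -
  interpret C: category C using G by (simp add: is_functor_def)
  have comp: "ArMap G (a, c) \<odot>\<^bsub>C\<^esub> \<psi> a = ArMap G (b, c) \<odot>\<^bsub>C\<^esub> \<psi> b"
    if "(a, b) \<in> gld_arrows I" "(b, c) \<in> gld_arrows I" "ArMap G (a, b) \<odot>\<^bsub>C\<^esub> \<psi> a = \<psi> b" for a b c
  proof -
    have "a \<in> Obj (GLD I)"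
      using gld_arrows_endpoints[OF that(1)] by (simp add: Obj_GLD)
    with functor_image_comp_cone[OF G, of "(a, b)" a b "(b, c)" c \<psi> N] that \<psi>
    show ?thesis by (simp add: Hom_GLD_iff Comp_GLD)
  qed
  have "ArMap G f \<odot>\<^bsub>C\<^esub> \<psi> (fst f) = \<psi> (snd f)" if "f \<in> gld_arrows I" for f
    using that
  proof (induction rule: gld_arrows.induct)
    case (gld_ident a)
    then have "a \<in> Obj (GLD I)" by (simp add: Obj_GLD)
    moreover from this have "ArMap G (a, a) = Ident C (ObMap G a)"
      using G by (auto simp: is_functor_def GLD_def)
    ultimately show ?case using C.Ident_Comp[OF \<psi>] by simp
  next
    case (gld_tau3 i j k)
    let ?ji = "cls2 I j i" and ?ij = "cls2 I i j" and ?jik = "cls3 I j i k" and ?ijk = "cls3 I i j k"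
    note arrows = gld_arrows.gld_eta23[OF gld_tau3(2,1,3), of i]
      gld_arrows.gld_eta23[OF gld_tau3, of j] gld_arrows.gld_tau2[OF gld_tau3(1,2)]
      gld_arrows.gld_tau3[OF gld_tau3]
    note compat = eta23[OF gld_tau3(2,1,3), of i] eta23[OF gld_tau3, of j] tau[OF gld_tau3(1,2)]
    \<comment> \<open>Both paths from \<open>[j,i]\<close> to \<open>[i,j,k]\<close> give the same arrow.\<close>
    have "ArMap G (?jik, ?ijk) \<odot>\<^bsub>C\<^esub> \<psi> ?jik = ArMap G (?ji, ?ijk) \<odot>\<^bsub>C\<^esub> \<psi> ?ji"
      using comp[of ?ji ?jik ?ijk] arrows compat by (simp add: eta_def tau3_def)
    also have "\<dots> = ArMap G (?ij, ?ijk) \<odot>\<^bsub>C\<^esub> \<psi> ?ij"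
      using comp[of ?ji ?ij ?ijk] arrows compat by (simp add: eta_def tau2_def)
    also have "\<dots> = \<psi> ?ijk"
      using compat by (simp add: eta_def)
    finally show ?case by (simp add: tau3_def)
  next
    case (gld_comp a b c)
    then show ?case using comp[of a b c] by simp
  qed (use tau eta12 eta23 in \<open>simp_all add: eta_def tau2_def\<close>)
  with N \<psi> show ?thesis
    by (auto simp: is_cone_def Hom_GLD_iff)
qed

lemma gld_coneD:
  assumes "is_cone (GLD I) C G N \<psi>" and "(a, b) \<in> gld_arrows I"
  shows "ArMap G (a, b) \<odot>\<^bsub>C\<^esub> \<psi> a = \<psi> b"
  using assms gld_arrows_endpoints[OF assms(2)]
  by (auto simp: is_cone_def Hom_GLD_iff Obj_GLD)

theorem lemma2p7:
  fixes I :: "'i set"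
    and C :: "('o, 'm) category"
    and G :: "('i tuple set, 'i gld_arrow, 'o, 'm) cat_functor"
    and N :: 'o
    and \<psi> :: "'i tuple set \<Rightarrow> 'm"
  assumes "category C"
    and "gluing_data_functor I C G"
    and "N \<in> Obj C"
    and "\<And>a. a \<in> Obj (GLD I) \<Longrightarrow> \<psi> a \<in> Hom C N (ObMap G a)"
  shows
    "(is_cone (GLD I) C G N \<psi> \<longleftrightarrow>
      (\<forall>i \<in> I. \<forall>j \<in> I. \<forall>k \<in> I. \<forall>n \<in> {j, k}.
        \<psi> (cls2 I i j) = ArMap G (tau2 I i j) \<odot>\<^bsub>C\<^esub> \<psi> (cls2 I j i) \<and>
        \<psi> (cls2 I i j) = ArMap G (eta (cls1 I i) (cls2 I i j)) \<odot>\<^bsub>C\<^esub> \<psi> (cls1 I i) \<and>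
        \<psi> (cls3 I i j k) = ArMap G (eta (cls2 I i n) (cls3 I i j k)) \<odot>\<^bsub>C\<^esub> \<psi> (cls2 I i n)))
     \<and>
     (is_cone (GLD I) C G N \<psi> \<longleftrightarrow>
      (\<forall>i \<in> I. \<forall>j \<in> I. \<forall>k \<in> I. \<forall>n \<in> {j, k}.
        \<psi> (cls2 I i j) =
          ArMap G (tau2 I i j \<odot>\<^bsub>GLD I\<^esub> eta (cls1 I j) (cls2 I j i)) \<odot>\<^bsub>C\<^esub> \<psi> (cls1 I j) \<and>
        \<psi> (cls2 I i j) = ArMap G (eta (cls1 I i) (cls2 I i j)) \<odot>\<^bsub>C\<^esub> \<psi> (cls1 I i) \<and>
        \<psi> (cls3 I i j k) = ArMap G (eta (cls2 I i n) (cls3 I i j k)) \<odot>\<^bsub>C\<^esub> \<psi> (cls2 I i n)))"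
proof -
  have G: "is_functor (GLD I) C G"
    using assms(2) by (simp add: gluing_data_functor_def)
  have generators: "is_cone (GLD I) C G N \<psi> \<longleftrightarrow>
      (\<forall>i \<in> I. \<forall>j \<in> I. \<forall>k \<in> I. \<forall>n \<in> {j, k}.
        \<psi> (cls2 I i j) = ArMap G (tau2 I i j) \<odot>\<^bsub>C\<^esub> \<psi> (cls2 I j i) \<and>
        \<psi> (cls2 I i j) = ArMap G (eta (cls1 I i) (cls2 I i j)) \<odot>\<^bsub>C\<^esub> \<psi> (cls1 I i) \<and>
        \<psi> (cls3 I i j k) = ArMap G (eta (cls2 I i n) (cls3 I i j k)) \<odot>\<^bsub>C\<^esub> \<psi> (cls2 I i n))"
    (is "_ \<longleftrightarrow> ?generators")
  proof
    assume cone: "is_cone (GLD I) C G N \<psi>"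
    show ?generators
      using gld_eta12[of _ I] gld_tau2[of _ I] gld_eta23[of _ I]
      by (auto simp: eta_def tau2_def gld_coneD[OF cone])
  next
    assume gen: ?generators
    show "is_cone (GLD I) C G N \<psi>"
    proof (rule gld_coneI[OF G assms(3,4)])
      fix i j assume ij: "i \<in> I" "j \<in> I"
      show "ArMap G (tau2 I i j) \<odot>\<^bsub>C\<^esub> \<psi> (cls2 I j i) = \<psi> (cls2 I i j)"
        and "ArMap G (eta (cls1 I i) (cls2 I i j)) \<odot>\<^bsub>C\<^esub> \<psi> (cls1 I i) = \<psi> (cls2 I i j)"
        using gen ij by (metis insertI1)+
    next
      fix i j k n assume "i \<in> I" "j \<in> I" "k \<in> I" "n \<in> {j, k}"
      then show "ArMap G (eta (cls2 I i n) (cls3 I i j k)) \<odot>\<^bsub>C\<^esub> \<psi> (cls2 I i n) = \<psi> (cls3 I i j k)"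
        using gen by metis
    qed
  qed
  have tau_via_eta: "ArMap G (tau2 I i j \<odot>\<^bsub>GLD I\<^esub> eta (cls1 I j) (cls2 I j i)) \<odot>\<^bsub>C\<^esub> \<psi> (cls1 I j)
      = ArMap G (tau2 I i j) \<odot>\<^bsub>C\<^esub> \<psi> (cls2 I j i)"
    if "i \<in> I" "j \<in> I"
      and "\<psi> (cls2 I j i) = ArMap G (eta (cls1 I j) (cls2 I j i)) \<odot>\<^bsub>C\<^esub> \<psi> (cls1 I j)" for i j
  proof (rule functor_image_comp_cone[OF G])
    show "eta (cls1 I j) (cls2 I j i) \<in> Hom (GLD I) (cls1 I j) (cls2 I j i)"
      using gld_eta12[OF that(2,1)] by (simp add: Hom_GLD_iff eta_def)
    show "tau2 I i j \<in> Hom (GLD I) (cls2 I j i) (cls2 I i j)"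
      using gld_tau2[OF that(1,2)] by (simp add: Hom_GLD_iff tau2_def)
    show "\<psi> (cls1 I j) \<in> Hom C N (ObMap G (cls1 I j))"
      using assms(4) that(2) by (simp add: Obj_GLD cls_in_quotient)
  qed (use that(3) in simp)
  \<comment> \<open>Rewriting clause (a) for \<open>(i, j)\<close> uses clause (b) for the swapped pair \<open>(j, i)\<close>, so the two
     lists of conditions agree only as wholes.\<close>
  show ?thesis
    unfolding generators
    by (intro conjI refl iffI ballI; metis tau_via_eta insertI1)
qed

end
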